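(* If a graph $G$ is $123$-representable, then (for a suitable labeling of its vertices by distinct elements of a totally ordered set) there exists a $123$-avoiding word $w$ representing $G$ in which every letter appears at most twice.
   Context: All graphs are simple. A word is a finite sequence of letters from a totally ordered alphabet. Two letters $x,y$ alternate in a word $w$ if between any two occurrences of $x$ there is an occurrence of $y$ and between any two occurrences of $y$ there is an occurrence of $x$. A graph $G=(V,E)$ is represented by a word $w$ over $V$ if for all distinct $x,y\in V$, $x$ and $y$ alternate in $w$ if and only if $xy\in E$. A word is $123$-avoiding if it has no strictly increasing subsequence of length $3$. A graph is $123$-representable if, after labeling its vertices by distinct elements of a totally ordered set (any labeling may be chosen), it is represented by a $123$-avoiding word. *)

theory Defs
  imports Main
begin

definition simple_graph :: "'a set \<Rightarrow> 'a set set \<Rightarrow> bool" where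
  "simple_graph V E \<longleftrightarrow> finite V \<and> (\<forall>e\<in>E. e \<subseteq> V \<and> card e = 2)"

definition separates :: "'a \<Rightarrow> 'a \<Rightarrow> 'a list \<Rightarrow> bool" where
  "separates y x w \<longleftrightarrow>
     (\<forall>i j. i < j \<and> j < length w \<and> w ! i = x \<and> w ! j = x \<longrightarrow>
        (\<exists>k. i < k \<and> k < j \<and> w ! k = y))"

definition alternate :: "'a \<Rightarrow> 'a \<Rightarrow> 'a list \<Rightarrow> bool" where
  "alternate x y w \<longleftrightarrow> separates y x w \<and> separates x y w"

text \<open>A word over \<open>V\<close> is not required to use every letter of \<open>V\<close>.\<close>

definition represents :: "'a list \<Rightarrow> 'a set \<Rightarrow> 'a set set \<Rightarrow> bool" where
  "represents w V E \<longleftrightarrow>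
     set w \<subseteq> V \<and>
     (\<forall>x\<in>V. \<forall>y\<in>V. x \<noteq> y \<longrightarrow> (alternate x y w \<longleftrightarrow> {x, y} \<in> E))"

definition avoids_123 :: "'l::linorder list \<Rightarrow> bool" where
  "avoids_123 w \<longleftrightarrow>
     \<not> (\<exists>i j k. i < j \<and> j < k \<and> k < length w \<and> w ! i < w ! j \<and> w ! j < w ! k)"

text \<open>
  The word \<open>w\<close> is a word in the labels: it represents the graph obtained from \<open>(V, E)\<close>
  by replacing every vertex \<open>v\<close> by its label \<open>lab v\<close>.
\<close>

definition represents_123 ::
    "('a \<Rightarrow> 'l::linorder) \<Rightarrow> 'l list \<Rightarrow> 'a set \<Rightarrow> 'a set set \<Rightarrow> bool" where
  "represents_123 lab w V E \<longleftrightarrow>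
     inj_on lab V \<and> represents w (lab ` V) ((`) lab ` E) \<and> avoids_123 w"

text \<open>
  HOL cannot quantify over types inside a formula, so the totally ordered set of labels is
  a type parameter.
\<close>

definition representable_123 ::
    "'l::linorder itself \<Rightarrow> 'a set \<Rightarrow> 'a set set \<Rightarrow> bool" where
  "representable_123 (_ :: 'l itself) V E \<longleftrightarrow>
     (\<exists>(lab :: 'a \<Rightarrow> 'l) w. represents_123 lab w V E)"

end

theory Submission
  imports Defs "HOL-Library.Sublist"
begin

text \<open>
  In a 123-avoiding word a letter \<open>x\<close> with at least three occurrences alternates with at most one
  other letter. If there is none, all occurrences of \<open>x\<close> are deleted and \<open>xx\<close> is put in front of
  the word, where \<open>x\<close> becomes the largest letter. If the only partner \<open>y\<close> of \<open>x\<close> also occurs at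
  least three times, then \<open>x\<close> and \<open>y\<close> form a component, and in the same way \<open>xyxy\<close> is put in front.
  Otherwise \<open>x\<close> is a leaf whose neighbour \<open>y\<close> occurs twice; for \<open>x < y\<close> all occurrences of \<open>x\<close>
  are deleted and the first \<open>y\<close> is replaced by \<open>xyx\<close>. The case \<open>x > y\<close> is the image of this under
  reversing both the word and the order. Each step removes a letter from the set of letters
  occurring at least three times.
\<close>

section \<open>Alternation and avoidance without indices\<close>

text \<open>Replaces positions by a factorization of the word at two occurrences of
  \<open>x\<close>, so that later proofs split words instead of computing indices.\<close>

lemma separates_iff_no_gap:
  "separates y x w \<longleftrightarrow> \<not> (\<exists>A B C. w = A @ x # B @ x # C \<and> y \<notin> set B)"
proof
  assume sep: "separates y x w"
  show "\<not> (\<exists>A B C. w = A @ x # B @ x # C \<and> y \<notin> set B)"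
  proof clarify
    fix A B C assume w: "w = A @ x # B @ x # C" and y: "y \<notin> set B"
    have "\<exists>k. length A < k \<and> k < Suc (length A + length B) \<and> w ! k = y"
      using sep unfolding separates_def by (rule allE[of _ "length A"]) (auto simp: w nth_append)
    then obtain k where k: "length A < k" "k < Suc (length A + length B)" "w ! k = y"
      by blast
    then have "w ! k = B ! (k - Suc (length A))" "k - Suc (length A) < length B"
      by (auto simp: w nth_append nth_Cons')
    with k have "y \<in> set B"
      by (metis nth_mem)
    with y show False by contradiction
  qed
next
  assume no_gap: "\<not> (\<exists>A B C. w = A @ x # B @ x # C \<and> y \<notin> set B)"
  show "separates y x w"
    unfolding separates_def
  proof (intro allI impI, elim conjE)
    fix i j assume ij: "i < j" "j < length w" "w ! i = x" "w ! j = x"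
    define B where "B = take (j - Suc i) (drop (Suc i) w)"
    have "w = take i w @ x # drop (Suc i) w"
      using ij id_take_nth_drop[of i w] by simp
    moreover have "drop (Suc i) w = B @ x # drop (Suc (j - Suc i)) (drop (Suc i) w)"
      using ij id_take_nth_drop[of "j - Suc i" "drop (Suc i) w"] by (simp add: B_def)
    ultimately have "y \<in> set B"
      using no_gap by metis
    then obtain m where "m < length B" "B ! m = y"
      by (auto simp: in_set_conv_nth)
    then show "\<exists>k. i < k \<and> k < j \<and> w ! k = y"
      using ij by (intro exI[of _ "Suc i + m"]) (auto simp: B_def)
  qed
qed

lemma not_distinct_adj_iff: "\<not> distinct_adj l \<longleftrightarrow> (\<exists>p a q. l = p @ a # a # q)"
proof
  assume "\<not> distinct_adj l"
  then obtain i where i: "Suc i < length l" "l ! i = l ! Suc i"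
    by (auto simp: distinct_adj_conv_nth)
  then have "l = take i l @ l ! i # l ! i # drop (Suc (Suc i)) l"
    by (metis Cons_nth_drop_Suc Suc_lessD append_take_drop_id)
  then show "\<exists>p a q. l = p @ a # a # q" by blast
qed (auto simp: distinct_adj_append_iff)

lemma filter_eq_appendD:
  "filter P w = p @ q \<Longrightarrow> \<exists>w1 w2. w = w1 @ w2 \<and> filter P w1 = p \<and> filter P w2 = q"
proof (induction p arbitrary: w)
  case Nil
  then show ?case by (intro exI[of _ "[]"] exI[of _ w]) simp
next
  case (Cons a p)
  then obtain us vs where w: "w = us @ a # vs" "\<forall>u\<in>set us. \<not> P u" "P a" "filter P vs = p @ q"
    by (auto simp: filter_eq_Cons_iff)
  with Cons.IH obtain w1 w2 where "vs = w1 @ w2" "filter P w1 = p" "filter P w2 = q" by blast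
  with w show ?case by (intro exI[of _ "us @ a # w1"] exI[of _ w2]) auto
qed

text \<open>Alternation depends only on the restriction of \<open>w\<close> to the two letters.
  Hence deleting or moving other letters cannot affect it, and reversal and injective renaming
  preserve it.\<close>

lemma alternate_iff_distinct_adj:
  assumes "x \<noteq> y"
  shows "alternate x y w \<longleftrightarrow> distinct_adj (filter (\<lambda>z. z = x \<or> z = y) w)"
proof -
  have gap: "\<not> distinct_adj (filter (\<lambda>z. z = x \<or> z = y) w)"
    if w: "w = A @ a # B @ a # C" and ab: "{a, b} = {x, y}" "b \<notin> set B" for A B C a b
  proof -
    have B: "set (filter (\<lambda>z. z = x \<or> z = y) B) \<subseteq> {a}"
      using ab by auto
    \<comment> \<open>The restriction of \<open>B\<close> is empty or starts with \<open>a\<close>;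
      either way \<open>a\<close> is followed directly by \<open>a\<close>.\<close>
    have "\<not> distinct_adj (a # filter (\<lambda>z. z = x \<or> z = y) B @ a # filter (\<lambda>z. z = x \<or> z = y) C)"
      using B by (cases "filter (\<lambda>z. z = x \<or> z = y) B") auto
    moreover have "a = x \<or> a = y" using ab by auto
    ultimately show ?thesis
      by (auto simp: w distinct_adj_append_iff)
  qed
  show ?thesis
  proof
    assume alt: "alternate x y w"
    show "distinct_adj (filter (\<lambda>z. z = x \<or> z = y) w)"
    proof (rule ccontr)
      assume "\<not> ?thesis"
      then obtain p a q where "filter (\<lambda>z. z = x \<or> z = y) w = p @ a # a # q"
        by (auto simp: not_distinct_adj_iff)
      then obtain w1 w2 where w: "w = w1 @ w2" "filter (\<lambda>z. z = x \<or> z = y) w2 = a # a # q"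
        by (blast dest: filter_eq_appendD)
      obtain us vs where us: "w2 = us @ a # vs" "a = x \<or> a = y"
        "a # q = filter (\<lambda>z. z = x \<or> z = y) vs"
        using filter_eq_ConsD[OF w(2)] by blast
      obtain B C where B: "vs = B @ a # C" "x \<notin> set B" "y \<notin> set B"
        using filter_eq_ConsD[OF us(3)[symmetric]] by blast
      have "w = (w1 @ us) @ a # B @ a # C" by (simp add: w us B)
      with alt us(2) B(2,3) show False
        unfolding alternate_def separates_iff_no_gap by blast
    qed
  next
    assume "distinct_adj (filter (\<lambda>z. z = x \<or> z = y) w)"
    with gap[of _ x _ _ y] gap[of _ y _ _ x] show "alternate x y w"
      unfolding alternate_def separates_iff_no_gap by blast
  qed
qed

lemma alternate_sym: "alternate x y w \<longleftrightarrow> alternate y x w"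
  by (auto simp: alternate_def)

section \<open>Increasing triples as subsequences\<close>

lemma subseq_Cons_iff_nth:
  "subseq (a # l) u \<longleftrightarrow> (\<exists>i < length u. u ! i = a \<and> subseq l (drop (Suc i) u))"
proof
  assume "subseq (a # l) u"
  then obtain us vs where "u = us @ a # vs" "subseq l vs"
    by (auto dest: list_emb_ConsD)
  then show "\<exists>i < length u. u ! i = a \<and> subseq l (drop (Suc i) u)"
    by (intro exI[of _ "length us"]) auto
next
  assume "\<exists>i < length u. u ! i = a \<and> subseq l (drop (Suc i) u)"
  then obtain i where "i < length u" "u ! i = a" "subseq l (drop (Suc i) u)" by blast
  then show "subseq (a # l) u"
    by (metis Cons_nth_drop_Suc append_take_drop_id subseq_Cons2 subseq_drop_many)
qed

lemma subseq_triple_iff_nth: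
  "subseq [a, b, c] u \<longleftrightarrow>
     (\<exists>i j k. i < j \<and> j < k \<and> k < length u \<and> u ! i = a \<and> u ! j = b \<and> u ! k = c)"
proof
  assume "subseq [a, b, c] u"
  then obtain i j k where "i < length u" "u ! i = a" "j < length u - Suc i" "u ! (Suc i + j) = b"
     "k < length u - Suc i - Suc j" "u ! (Suc i + (Suc j + k)) = c"
    by (auto simp: subseq_Cons_iff_nth simp del: list_emb_Cons_iff1 list_emb_Cons_iff2)
       (metis add.commute add.assoc)
  then show "\<exists>i j k. i < j \<and> j < k \<and> k < length u \<and> u ! i = a \<and> u ! j = b \<and> u ! k = c"
    by (intro exI[of _ i] exI[of _ "Suc i + j"] exI[of _ "Suc i + (Suc j + k)"]) auto
next
  assume "\<exists>i j k. i < j \<and> j < k \<and> k < length u \<and> u ! i = a \<and> u ! j = b \<and> u ! k = c"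
  then obtain i j k where "i < j" "j < k" "k < length u" "u ! i = a" "u ! j = b" "u ! k = c"
    by blast
  then have "subseq [c] (drop (Suc j) u)" "j < length u" "i < length u"
    by (auto simp: subseq_Cons_iff_nth intro!: exI[of _ "k - Suc j"])
  then have "subseq [b, c] (drop (Suc i) u)"
    using \<open>i < j\<close> \<open>u ! j = b\<close> by (subst subseq_Cons_iff_nth) (auto intro!: exI[of _ "j - Suc i"])
  then show "subseq [a, b, c] u"
    using \<open>i < length u\<close> \<open>u ! i = a\<close> by (subst subseq_Cons_iff_nth) blast
qed

text \<open>The word \<open>u\<close> and the order induced by \<open>f\<close> appear separately
  here, so each can be changed while the other is kept.\<close>

lemma avoids_123_map_iff:
  "avoids_123 (map f u) \<longleftrightarrow> (\<forall>a b c. subseq [a, b, c] u \<longrightarrow> \<not> (f a < f b \<and> f b < f c))"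
proof
  assume avoids: "avoids_123 (map f u)"
  show "\<forall>a b c. subseq [a, b, c] u \<longrightarrow> \<not> (f a < f b \<and> f b < f c)"
  proof clarify
    fix a b c assume abc: "subseq [a, b, c] u" "f a < f b" "f b < f c"
    then obtain i j k where "i < j" "j < k" "k < length u" "u ! i = a" "u ! j = b" "u ! k = c"
      unfolding subseq_triple_iff_nth by blast
    with abc have "map f u ! i < map f u ! j" "map f u ! j < map f u ! k" "k < length (map f u)"
      by auto
    with avoids \<open>i < j\<close> \<open>j < k\<close> show False
      unfolding avoids_123_def by blast
  qed
next
  assume avoids: "\<forall>a b c. subseq [a, b, c] u \<longrightarrow> \<not> (f a < f b \<and> f b < f c)"
  show "avoids_123 (map f u)"
    unfolding avoids_123_def
  proof clarify
    fix i j k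
    assume ijk: "i < j" "j < k" "k < length (map f u)" "map f u ! i < map f u ! j"
      "map f u ! j < map f u ! k"
    then have "subseq [u ! i, u ! j, u ! k] u"
      unfolding subseq_triple_iff_nth by auto
    with avoids ijk show False by simp
  qed
qed

lemma avoids_123_map_mono:
  assumes "avoids_123 (map f u)"
    and "\<And>a b. a \<in> set u \<Longrightarrow> b \<in> set u \<Longrightarrow> g a < g b \<Longrightarrow> f a < f b"
  shows "avoids_123 (map g u)"
  unfolding avoids_123_map_iff
proof clarify
  fix a b c assume abc: "subseq [a, b, c] u" "g a < g b" "g b < g c"
  from abc(1) have "a \<in> set u" "b \<in> set u" "c \<in> set u"
    unfolding subseq_triple_iff_nth by auto
  with abc assms show False
    unfolding avoids_123_map_iff by blast
qed

lemma avoids_123_map_subseq: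
  "avoids_123 (map f u) \<Longrightarrow> subseq v u \<Longrightarrow> avoids_123 (map f v)"
  unfolding avoids_123_map_iff using subseq_order.trans by blast

lemma subseq_rev: "subseq u v \<Longrightarrow> subseq (rev u) (rev v)"
  by (induction rule: list_emb.induct) (auto intro: list_emb_append_mono)

lemma avoids_123_map_rev_uminus:
  fixes f :: "'a \<Rightarrow> int"
  shows "avoids_123 (map (\<lambda>v. - f v) (rev u)) \<longleftrightarrow> avoids_123 (map f u)"
proof -
  have "subseq [a, b, c] (rev u) \<longleftrightarrow> subseq [c, b, a] u" for a b c
    using subseq_rev[of "[c, b, a]" u] subseq_rev[of "[a, b, c]" "rev u"] by auto
  then show ?thesis unfolding avoids_123_map_iff by auto
qed


text \<open>An increasing triple across the cut would start in \<open>p\<close> and end in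
  \<open>q\<close>, where ranks are no larger.\<close>

lemma avoids_123_map_append:
  assumes "avoids_123 (map f p)" "avoids_123 (map f q)"
    and below: "\<And>a b. a \<in> set p \<Longrightarrow> b \<in> set q \<Longrightarrow> f b \<le> f a"
  shows "avoids_123 (map f (p @ q))"
  unfolding avoids_123_map_iff
proof clarify
  fix a b c assume abc: "subseq [a, b, c] (p @ q)" "f a < f b" "f b < f c"
  then obtain xs ys where xy: "[a, b, c] = xs @ ys" "subseq xs p" "subseq ys q"
    by (auto elim: subseq_appendE)
  have sub: "set xs \<subseteq> set p" "set ys \<subseteq> set q"
    using xy by (auto elim: list_emb_set)
  show False
  proof (cases "xs = [] \<or> ys = []")
    case True
    with xy abc assms(1,2) show False
      unfolding avoids_123_map_iff by auto
  next
    case False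
    with xy(1) sub have "a \<in> set p" "c \<in> set q" "b \<in> set p \<or> b \<in> set q"
      by (auto simp: Cons_eq_append_conv)
    with abc below[of a c] show False by auto
  qed
qed

section \<open>Words over the vertices with integer ranks\<close>

text \<open>The letters are the vertices themselves, and only the ranks carry the order. Integers
  allow the order to be reversed by negation and always leave room above a finite set, which a given
  label type need not.\<close>

definition ranked_represents :: "('a \<Rightarrow> int) \<Rightarrow> 'a list \<Rightarrow> 'a set \<Rightarrow> 'a set set \<Rightarrow> bool" where
  "ranked_represents f u V E \<longleftrightarrow> inj_on f V \<and> represents u V E \<and> avoids_123 (map f u)"

lemma alternate_rev: "x \<noteq> y \<Longrightarrow> alternate x y (rev u) \<longleftrightarrow> alternate x y u"
  by (simp add: alternate_iff_distinct_adj flip: rev_filter)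

lemma ranked_represents_rev:
  "ranked_represents (\<lambda>v. - f v) (rev u) V E \<longleftrightarrow> ranked_represents f u V E"
  unfolding ranked_represents_def avoids_123_map_rev_uminus represents_def
  by (auto simp: alternate_rev inj_on_def)

section \<open>Letters with at least three occurrences\<close>

lemma split_at_first_occurrence:
  assumes "Suc n \<le> count_list u x"
  obtains A v where "u = A @ x # v" "x \<notin> set A" "n \<le> count_list v x"
proof -
  from assms have "x \<in> set u"
    using count_list_0_iff[of u x] by auto
  then obtain A v where "u = A @ x # v" "x \<notin> set A"
    using split_list_first by metis
  with assms that[of A v] show thesis by simp
qed

lemma split_at_three_occurrences:
  assumes "3 \<le> count_list u x"
  obtains A B C D where "u = A @ x # B @ x # C @ x # D" "x \<notin> set A" "x \<notin> set B" "x \<notin> set C"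
proof -
  from assms obtain A v1 where 1: "u = A @ x # v1" "x \<notin> set A" "Suc (Suc 0) \<le> count_list v1 x"
    using split_at_first_occurrence[of "Suc (Suc 0)" u x] by auto
  from 1(3) obtain B v2 where 2: "v1 = B @ x # v2" "x \<notin> set B" "Suc 0 \<le> count_list v2 x"
    by (rule split_at_first_occurrence)
  from 2(3) obtain C D where "v2 = C @ x # D" "x \<notin> set C"
    by (rule split_at_first_occurrence)
  with 1 2 that show thesis by simp
qed

lemma alternateD_gap:
  "alternate x y (A @ x # B @ x # C) \<Longrightarrow> y \<in> set B"
  unfolding alternate_def separates_iff_no_gap by blast

text \<open>
  With \<open>y\<close> and \<open>z\<close> in both gaps between three occurrences of \<open>x\<close>, the three letters occur in
  each of the six possible orders, one of which is increasing.
\<close>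

lemma alternating_partner_unique:
  fixes f :: "'a \<Rightarrow> 'b::linorder"
  assumes avoids: "avoids_123 (map f u)" and count: "3 \<le> count_list u x"
    and y: "alternate x y u" and z: "alternate x z u"
    and neq: "x \<noteq> y" "x \<noteq> z" and inj: "inj_on f {x, y, z}"
  shows "y = z"
proof (rule ccontr)
  assume "y \<noteq> z"
  obtain A B C D where u: "u = A @ x # B @ x # C @ x # D"
    using count by (rule split_at_three_occurrences)
  have gaps: "t \<in> set B" "t \<in> set C" if "alternate x t u" for t
    using that alternateD_gap[of x t A B "C @ x # D"] alternateD_gap[of x t "A @ x # B" C D]
    by (simp_all add: u)
  have "subseq [x, a, x, b, x] u" if "a \<in> {y, z}" "b \<in> {y, z}" for a b
  proof -
    have "subseq ([] @ [x] @ [a] @ [x] @ [b] @ [x] @ []) (A @ [x] @ B @ [x] @ C @ [x] @ D)"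
      by (intro list_emb_append_mono) (use that gaps y z in \<open>auto simp: subseq_singleton_left\<close>)
    then show ?thesis by (simp add: u)
  qed
  then have yz: "subseq [x, y, x, z, x] u" and zy: "subseq [x, z, x, y, x] u"
    by auto
  have sub: "subseq [x, a, b] [x, a, x, b, x]" "subseq [a, x, b] [x, a, x, b, x]"
    "subseq [a, b, x] [x, a, x, b, x]" for a b
    by (auto intro: list_emb.intros)
  have "subseq [x, y, z] u" "subseq [y, x, z] u" "subseq [y, z, x] u"
    "subseq [x, z, y] u" "subseq [z, x, y] u" "subseq [z, y, x] u"
    using sub yz zy subseq_order.trans by blast+
  then have "\<not> (f a < f b \<and> f b < f c)"
    if "(a, b, c) \<in> {(x, y, z), (y, x, z), (y, z, x), (x, z, y), (z, x, y), (z, y, x)}" for a b c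
    using avoids that unfolding avoids_123_map_iff by blast
  moreover have "f x \<noteq> f y" "f x \<noteq> f z" "f y \<noteq> f z"
    using neq \<open>y \<noteq> z\<close> inj by (auto simp: inj_on_def)
  ultimately show False
    by (metis insertCI linorder_neqE)
qed

section \<open>Reducing the number of occurrences of a letter\<close>

text \<open>All of \<open>S\<close> is ranked above the rest, so no increasing triple meets both
  \<open>p\<close> and the remaining word. Each letter of \<open>S\<close> occurs twice before any
  letter outside \<open>S\<close>, so no alternation arises between the two sides.\<close>

lemma ranked_represents_replace_component:
  fixes g :: "'a \<Rightarrow> int"
  assumes rep: "ranked_represents f u V E" and "finite V" and S: "S \<subseteq> V"
    and no_edges: "\<And>x z. x \<in> S \<Longrightarrow> z \<in> V - S \<Longrightarrow> {x, z} \<notin> E"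
    and p: "set p \<subseteq> S" "\<And>x. x \<in> S \<Longrightarrow> count_list p x = 2"
    and edges: "\<And>x y. x \<in> S \<Longrightarrow> y \<in> S \<Longrightarrow> x \<noteq> y \<Longrightarrow> alternate x y p \<longleftrightarrow> {x, y} \<in> E"
    and g: "inj_on g S" "avoids_123 (map g p)"
  shows "\<exists>f'. ranked_represents f' (p @ filter (\<lambda>v. v \<notin> S) u) V E"
proof -
  \<comment> \<open>Shifting by \<open>m\<close> lifts the least value of \<open>g\<close> on
    \<open>S\<close> just above the greatest value of \<open>f\<close> on \<open>V\<close>.
    Inserting 0 keeps \<open>Max\<close> and \<open>Min\<close> meaningful for empty sets.\<close>
  define m where "m = 1 + Max (insert 0 (f ` V)) - Min (insert 0 (g ` S))"
  define f' where "f' = (\<lambda>v. if v \<in> S then m + g v else f v)"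
  define q where "q = filter (\<lambda>v. v \<notin> S) u"
  have finS: "finite S" using S \<open>finite V\<close> finite_subset by blast
  have inj: "inj_on f V" and u: "represents u V E" "avoids_123 (map f u)"
    using rep by (auto simp: ranked_represents_def)
  have above: "f b < f' a" if "a \<in> S" "b \<in> V" for a b
  proof -
    have "f b \<le> Max (insert 0 (f ` V))" "Min (insert 0 (g ` S)) \<le> g a"
      using that finS \<open>finite V\<close> by auto
    with \<open>a \<in> S\<close> show ?thesis by (simp add: f'_def m_def)
  qed
  have inj': "inj_on f' V"
  proof (rule inj_onI)
    fix a b assume ab: "a \<in> V" "b \<in> V" "f' a = f' b"
    then show "a = b"
      using above[of a b] above[of b a] inj g(1)
      by (auto simp: f'_def inj_on_def split: if_splits)
  qed
  have q: "set q \<subseteq> V - S"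
    using u(1) by (auto simp: q_def represents_def)
  have "avoids_123 (map f' (p @ q))"
  proof (rule avoids_123_map_append)
    show "avoids_123 (map f' p)"
      using g(2) by (rule avoids_123_map_mono) (use p in \<open>auto simp: f'_def subset_iff\<close>)
    have "avoids_123 (map f q)"
      using u(2) by (rule avoids_123_map_subseq) (simp add: q_def)
    then show "avoids_123 (map f' q)"
      by (rule avoids_123_map_mono) (use q in \<open>auto simp: f'_def subset_iff\<close>)
    show "f' b \<le> f' a" if "a \<in> set p" "b \<in> set q" for a b
      using above[of a b] that p(1) q by (auto simp: f'_def subset_iff)
  qed
  moreover have "represents (p @ q) V E"
  proof -
    \<comment> \<open>The restriction of \<open>p @ q\<close> to \<open>a\<close> and
      \<open>b\<close> starts with \<open>a\<close>, \<open>a\<close>.\<close>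
    have cross: "\<not> alternate a b (p @ q)" if "a \<in> S" "b \<in> V - S" for a b
    proof -
      have "filter (\<lambda>z. z = a \<or> z = b) p = filter ((=) a) p"
        using that p(1) by (intro filter_cong) auto
      also have "\<dots> = replicate (count_list p a) a"
        by (simp add: count_list_eq_length_filter replicate_length_filter)
      also have "\<dots> = [a, a]"
        using p(2) that by (simp add: numeral_2_eq_2)
      finally show ?thesis
        using that by (subst alternate_iff_distinct_adj) auto
    qed
    have "alternate a b (p @ q) \<longleftrightarrow> {a, b} \<in> E" if ab: "a \<in> V" "b \<in> V" "a \<noteq> b" for a b
    proof -
      consider "a \<in> S" "b \<in> S" | "a \<in> S" "b \<notin> S" | "a \<notin> S" "b \<in> S" | "a \<notin> S" "b \<notin> S" by blast
      then show ?thesis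
      proof cases
        case 1
        then have "filter (\<lambda>z. z = a \<or> z = b) q = []"
          using q by (auto simp: filter_empty_conv)
        with edges[OF 1 ab(3)] show ?thesis
          using ab by (simp add: alternate_iff_distinct_adj)
      next
        case 2
        with cross no_edges ab show ?thesis by blast
      next
        case 3
        with cross[of b a] no_edges[of b a] ab show ?thesis
          by (simp add: alternate_sym[of a b] insert_commute)
      next
        case 4
        then have "filter (\<lambda>z. z = a \<or> z = b) p = []"
          using p(1) by (auto simp: filter_empty_conv)
        moreover have "filter (\<lambda>z. z = a \<or> z = b) q = filter (\<lambda>z. z = a \<or> z = b) u"
          unfolding q_def filter_filter using 4 by (intro filter_cong) auto
        moreover have "alternate a b u \<longleftrightarrow> {a, b} \<in> E"
          using u(1) ab by (simp add: represents_def)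
        ultimately show ?thesis
          using ab by (simp add: alternate_iff_distinct_adj)
      qed
    qed
    with p(1) q S show ?thesis by (auto simp: represents_def)
  qed
  ultimately show ?thesis
    using inj' by (auto simp: ranked_represents_def q_def)
qed

text \<open>
  The other letters before the second \<open>x\<close> all exceed \<open>x\<close>, so an increasing triple cannot use an \<open>x\<close>
  placed there other than as its first element; this allows the first \<open>x\<close> to be moved next to
  the first \<open>y\<close>. The resulting factor \<open>xyx\<close> ensures that \<open>x\<close> alternates with \<open>y\<close> only.
\<close>

lemma ranked_represents_shorten_leaf_less:
  assumes rep: "ranked_represents f u V E" and xy: "x \<in> V" "y \<in> V" "x \<noteq> y" "{x, y} \<in> E"
    and count: "3 \<le> count_list u x" "count_list u y = 2" and less: "f x < f y"
  shows "\<exists>u'. ranked_represents f u' V E \<and> count_list u' x = 2 \<and>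
           (\<forall>v. v \<noteq> x \<longrightarrow> count_list u' v = count_list u v)"
proof -
  have inj: "inj_on f V" and V: "set u \<subseteq> V" and avoids: "avoids_123 (map f u)"
    and edge: "\<And>a b. a \<in> V \<Longrightarrow> b \<in> V \<Longrightarrow> a \<noteq> b \<Longrightarrow> alternate a b u \<longleftrightarrow> {a, b} \<in> E"
    using rep by (auto simp: ranked_represents_def represents_def)
  have alt: "alternate x y u" using edge xy by blast
  obtain A B' D' G where u0: "u = A @ x # B' @ x # D' @ x # G"
    and x0: "x \<notin> set A" "x \<notin> set B'" "x \<notin> set D'"
    using count(1) by (rule split_at_three_occurrences)
  have "y \<in> set B'" "y \<in> set D'"
    using alt alternateD_gap[of x y A B' "D' @ x # G"] alternateD_gap[of x y "A @ x # B'" D' G]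
    by (simp_all add: u0)
  then obtain B C D F where BCDF: "B' = B @ y # C" "D' = D @ y # F"
    by (metis split_list)
  have u: "u = A @ x # B @ y # C @ x # D @ y # F @ x # G"
    by (simp add: u0 BCDF)
  have "count_list A y + count_list B y + count_list C y + count_list D y + count_list F y
      + count_list G y = 0"
    using count(2) xy(3) by (simp add: u)
  then have y: "y \<notin> set A" "y \<notin> set B" "y \<notin> set C" "y \<notin> set D" "y \<notin> set F" "y \<notin> set G"
    by (simp_all add: count_list_0_iff)
  have x: "x \<notin> set A" "x \<notin> set B" "x \<notin> set C" "x \<notin> set D" "x \<notin> set F" "x \<notin> set G"
  proof -
    \<comment> \<open>A fourth \<open>x\<close> would follow the third with no \<open>y\<close> in
      between, so \<open>x\<close> occurs exactly three times.\<close>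
    show "x \<notin> set G"
    proof
      assume "x \<in> set G"
      then obtain G1 G2 where "G = G1 @ x # G2" by (metis split_list)
      with alt y alternateD_gap[of x y "A @ x # B @ y # C @ x # D @ y # F" G1 G2] show False
        by (simp add: u)
    qed
  qed (use x0 BCDF in auto)
  have no_inc: "\<not> (f a < f b \<and> f b < f c)" if "subseq [a, b, c] u" for a b c
    using that avoids unfolding avoids_123_map_iff by blast
  \<comment> \<open>Otherwise \<open>t\<close>, the second \<open>x\<close> and the second
    \<open>y\<close> form an increasing triple.\<close>
  have above: "f x < f t" if "t \<in> set A \<union> set B \<union> set C" for t
  proof -
    have "t \<in> set (A @ x # B @ y # C)" using that by auto
    then have "subseq ([t] @ [x] @ [] @ [y] @ []) ((A @ x # B @ y # C) @ [x] @ D @ [y] @ F @ x # G)"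
      by (intro list_emb_append_mono) (auto simp: subseq_singleton_left)
    then have "\<not> f t < f x"
      using no_inc[of t x y] less by (simp add: u)
    moreover have "t \<noteq> x" "t \<in> V" using that x V by (auto simp: u)
    then have "f t \<noteq> f x" using inj xy by (auto simp: inj_on_def)
    ultimately show ?thesis by simp
  qed
  \<comment> \<open>A letter \<open>t\<close> of \<open>C\<close> exceeds \<open>x\<close>. If it
    lies below \<open>y\<close>, then \<open>x\<close>, \<open>t\<close> and the second
    \<open>y\<close> increase; if above, the first \<open>x\<close>, the first \<open>y\<close> and
    \<open>t\<close> do.\<close>
  have "C = []"
  proof (rule ccontr)
    assume "C \<noteq> []"
    then obtain t where t: "t \<in> set C" by (cases C) auto
    have "subseq ([] @ [x] @ [] @ [] @ [t] @ [] @ [] @ [y] @ [])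
        (A @ [x] @ B @ [y] @ C @ [x] @ D @ [y] @ F @ x # G)"
      by (intro list_emb_append_mono) (use t in \<open>auto simp: subseq_singleton_left\<close>)
    then have "\<not> f t < f y"
      using no_inc[of x t y] above[of t] t by (simp add: u)
    moreover have "subseq ([] @ [x] @ [] @ [y] @ [t] @ [])
        (A @ [x] @ B @ [y] @ C @ x # D @ y # F @ x # G)"
      by (intro list_emb_append_mono) (use t in \<open>auto simp: subseq_singleton_left\<close>)
    then have "\<not> f y < f t"
      using no_inc[of x y t] less by (simp add: u)
    moreover have "f t \<noteq> f y"
      using t y V inj xy by (auto simp: u inj_on_def)
    ultimately show False by simp
  qed
  \<comment> \<open>In \<open>u'\<close> the first \<open>x\<close> has moved past \<open>B\<close>
    to the first \<open>y\<close>, and the third \<open>x\<close> is gone.\<close>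
  define R where "R = y # x # D @ y # F @ G"
  define u' where "u' = (A @ B) @ x # R"
  \<comment> \<open>Dropping either the moved \<open>x\<close> or the prefix \<open>A @ B\<close>
    from \<open>u'\<close> leaves a subsequence of \<open>u\<close>. So an increasing triple of
    \<open>u'\<close> must use both the moved \<open>x\<close> and a letter before it.\<close>
  have R: "subseq ((A @ B) @ R) u" "subseq (x # R) u"
  proof -
    have tail: "subseq R (y # x # D @ y # F @ x # G)"
      unfolding R_def by (intro subseq_Cons2 list_emb_append_mono) auto
    then have "subseq ((A @ B) @ [] @ R) ((A @ [x] @ B) @ [] @ (y # x # D @ y # F @ x # G))"
      by (intro list_emb_append_mono) auto
    then show "subseq ((A @ B) @ R) u" by (simp add: u \<open>C = []\<close>)
    from tail have "subseq ([] @ [x] @ [] @ R) (A @ [x] @ B @ (y # x # D @ y # F @ x # G))"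
      by (intro list_emb_append_mono) auto
    then show "subseq (x # R) u" by (simp add: u \<open>C = []\<close>)
  qed
  have "avoids_123 (map f u')"
    unfolding avoids_123_map_iff
  proof clarify
    fix a b c assume abc: "subseq [a, b, c] u'" "f a < f b" "f b < f c"
    from abc(1) obtain xs ys
      where split: "[a, b, c] = xs @ ys" "subseq xs (A @ B)" "subseq ys (x # R)"
      unfolding u'_def by (rule subseq_appendE)
    show False
    proof (cases "subseq ys R")
      case True
      with split have "subseq (xs @ ys) ((A @ B) @ R)"
        by (intro list_emb_append_mono)
      with split have "subseq [a, b, c] u" using R(1) subseq_order.trans by metis
      with no_inc abc show False by blast
    next
      case False
      with split(3) have ys: "ys \<noteq> []" "hd ys = x"
        by (cases ys; auto split: if_splits dest: subseq_Cons2_neq)+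
      show False
      proof (cases xs)
        case Nil
        with split have "subseq [a, b, c] u" using R(2) subseq_order.trans by (metis append_Nil)
        with no_inc abc show False by blast
      next
        case (Cons a' xs')
        with split(1) have "a \<in> set xs" by simp
        with split(2) have "a \<in> set A \<union> set B" by (auto elim: list_emb_set)
        then have "f x < f a" using above by blast
        moreover have "x = b \<or> x = c"
          using split(1) ys Cons by (auto simp: Cons_eq_append_conv)
        ultimately show False using abc by auto
      qed
    qed
  qed
  moreover have "represents u' V E"
  proof -
    have partner: "alternate x b u' \<longleftrightarrow> {x, b} \<in> E" if b: "b \<in> V" "x \<noteq> b" for b
    proof (cases "b = y")
      case True
      have "filter (\<lambda>z. z = x \<or> z = y) L = []" if "L \<in> {A, B, D, F, G}" for L
        using that x y by (auto simp: filter_empty_conv)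
      then have "filter (\<lambda>z. z = x \<or> z = y) u' = [x, y, x, y]"
        by (simp add: u'_def R_def)
      with True xy show ?thesis by (simp add: alternate_iff_distinct_adj)
    next
      case False
      have "inj_on f {x, y, b}"
        by (rule inj_on_subset[OF inj]) (use xy b in auto)
      \<comment> \<open>In \<open>u\<close> the letter \<open>x\<close> still occurs three times and
        already has the partner \<open>y\<close>.\<close>
      then have "\<not> alternate x b u"
        using alternating_partner_unique[OF avoids count(1) alt _ xy(3) b(2)] False by blast
      moreover have "\<not> alternate x b u'"
        using alternateD_gap[of x b "A @ B" "[y]" "D @ y # F @ G"] False
        by (auto simp: u'_def R_def)
      ultimately show ?thesis using edge xy b by blast
    qed
    have "alternate a b u' \<longleftrightarrow> {a, b} \<in> E" if ab: "a \<in> V" "b \<in> V" "a \<noteq> b" for a b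
    proof -
      consider "a = x" | "b = x" | "a \<noteq> x" "b \<noteq> x" by blast
      then show ?thesis
      proof cases
        case 1
        with partner ab show ?thesis by blast
      next
        case 2
        with partner[of a] ab show ?thesis by (simp add: alternate_sym[of a x] insert_commute)
      next
        case 3
        then have "filter (\<lambda>z. z = a \<or> z = b) u' = filter (\<lambda>z. z = a \<or> z = b) u"
          by (simp add: u u'_def R_def \<open>C = []\<close>)
        with edge[OF ab] ab show ?thesis by (simp add: alternate_iff_distinct_adj)
      qed
    qed
    moreover have "set u' \<subseteq> V" using V by (auto simp: u u'_def R_def)
    ultimately show ?thesis by (auto simp: represents_def)
  qed
  moreover have "count_list u' x = 2"
    using x xy by (simp add: u'_def R_def)
  moreover have "count_list u' v = count_list u v" if "v \<noteq> x" for v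
    using that by (simp add: u u'_def R_def \<open>C = []\<close>)
  ultimately show ?thesis
    using inj by (auto simp: ranked_represents_def)
qed

text \<open>For \<open>f y < f x\<close>, reversing the word and negating the ranks gives the
  previous situation; reversing the result leads back.\<close>

lemma ranked_represents_shorten_leaf:
  assumes rep: "ranked_represents f u V E" and xy: "x \<in> V" "y \<in> V" "x \<noteq> y" "{x, y} \<in> E"
    and count: "3 \<le> count_list u x" "count_list u y = 2"
  shows "\<exists>u'. ranked_represents f u' V E \<and> count_list u' x = 2 \<and>
           (\<forall>v. v \<noteq> x \<longrightarrow> count_list u' v = count_list u v)"
proof (cases "f x < f y")
  case True
  show ?thesis by (rule ranked_represents_shorten_leaf_less[OF assms True])
next
  case False
  with rep xy have "- f x < - f y"
    by (auto simp: ranked_represents_def inj_on_def order_less_le)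
  then obtain u' where u': "ranked_represents (\<lambda>v. - f v) u' V E" "count_list u' x = 2"
    "\<forall>v. v \<noteq> x \<longrightarrow> count_list u' v = count_list u v"
    using ranked_represents_shorten_leaf_less[of "\<lambda>v. - f v" "rev u" V E x y] assms
    by (auto simp: ranked_represents_rev)
  have "ranked_represents f (rev u') V E"
    using u'(1) ranked_represents_rev[of f "rev u'" V E] by simp
  with u' show ?thesis
    by (intro exI[of _ "rev u'"]) simp
qed

lemma count_list_filter: "count_list (filter P u) x = (if P x then count_list u x else 0)"
  by (induction u) auto

text \<open>The strict inclusion records that \<open>x\<close> leaves the set of letters occurring
  at least three times and that no letter enters it.\<close>

lemma ranked_represents_shorten_letter:
  assumes rep: "ranked_represents f u V E" and "finite V" and count: "3 \<le> count_list u x"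
  shows "\<exists>f' u'. ranked_represents f' u' V E \<and> {v. 3 \<le> count_list u' v} \<subset> {v. 3 \<le> count_list u v}"
proof -
  have inj: "inj_on f V" and V: "set u \<subseteq> V" and avoids: "avoids_123 (map f u)"
    and edge: "\<And>a b. a \<in> V \<Longrightarrow> b \<in> V \<Longrightarrow> a \<noteq> b \<Longrightarrow> alternate a b u \<longleftrightarrow> {a, b} \<in> E"
    using rep by (auto simp: ranked_represents_def represents_def)
  \<comment> \<open>Stated for an arbitrary such letter \<open>a\<close>, because it is applied to
    \<open>x\<close> and \<open>y\<close> alike when both occur at least three times.\<close>
  have unique: "b = c" if "3 \<le> count_list u a" "a \<in> V" "b \<in> V" "c \<in> V" "a \<noteq> b" "a \<noteq> c"
    "{a, b} \<in> E" "{a, c} \<in> E" for a b c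
  proof -
    have "inj_on f {a, b, c}"
      by (rule inj_on_subset[OF inj]) (use that in auto)
    with alternating_partner_unique[OF avoids that(1), of b c] edge that show ?thesis
      by blast
  qed
  have "x \<in> V"
    using count V count_list_0_iff[of u x] by auto
  show ?thesis
  proof (cases "\<exists>y \<in> V. y \<noteq> x \<and> {x, y} \<in> E")
    case False
    have "\<exists>f'. ranked_represents f' ([x, x] @ filter (\<lambda>v. v \<notin> {x}) u) V E"
      by (rule ranked_represents_replace_component[OF rep \<open>finite V\<close>, where g = "\<lambda>_. 0"])
        (use False \<open>x \<in> V\<close> in \<open>auto simp: avoids_123_def\<close>)
    then obtain f' where "ranked_represents f' ([x, x] @ filter (\<lambda>v. v \<notin> {x}) u) V E" ..
    moreover have "{v. 3 \<le> count_list ([x, x] @ filter (\<lambda>v. v \<notin> {x}) u) v} \<subset> {v. 3 \<le> count_list u v}"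
      using count by (auto simp: count_list_filter split: if_splits)
    ultimately show ?thesis by blast
  next
    case True
    then obtain y where y: "y \<in> V" "y \<noteq> x" "{x, y} \<in> E" by blast
    then have alt: "alternate x y u" using edge \<open>x \<in> V\<close> by blast
    show ?thesis
    proof (cases "3 \<le> count_list u y")
      case False
      obtain A B C D where u: "u = A @ x # B @ x # C @ x # D"
        using count by (rule split_at_three_occurrences)
      have "y \<in> set B" "y \<in> set C"
        using alt alternateD_gap[of x y A B "C @ x # D"] alternateD_gap[of x y "A @ x # B" C D]
        by (simp_all add: u)
      \<comment> \<open>One \<open>y\<close> in each gap gives at least two occurrences, and the
        case assumption gives at most two.\<close>
      then have "count_list B y \<noteq> 0" "count_list C y \<noteq> 0"
        by (simp_all add: count_list_0_iff)
      with False have "count_list u y = 2" using y by (simp add: u)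
      then obtain u' where u': "ranked_represents f u' V E" "count_list u' x = 2"
        "\<forall>v. v \<noteq> x \<longrightarrow> count_list u' v = count_list u v"
        using ranked_represents_shorten_leaf[OF rep \<open>x \<in> V\<close> y(1) y(2)[symmetric] y(3) count] by blast
      have "v \<noteq> x \<and> 3 \<le> count_list u v" if "3 \<le> count_list u' v" for v
        using that u'(2,3) by (cases "v = x") auto
      with count have "{v. 3 \<le> count_list u' v} \<subset> {v. 3 \<le> count_list u v}"
        by blast
      with u'(1) show ?thesis by blast
    next
      case True
      have no_edges: "{a, z} \<notin> E" if "a \<in> {x, y}" "z \<in> V - {x, y}" for a z
        using that unique[of x y z] unique[of y x z] count True y \<open>x \<in> V\<close>
        by (auto simp: insert_commute)
      \<comment> \<open>Two values cannot form an increasing triple, so every word avoids 123 under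
        \<open>g\<close>.\<close>
      define g where "g = (\<lambda>v. if v = x then 0 else 1 :: int)"
      have avoids_g: "avoids_123 (map g p)" for p
        by (auto simp: avoids_123_map_iff g_def)
      have alt_p: "alternate x y [x, y, x, y]"
        using y by (simp add: alternate_iff_distinct_adj)
      have "\<exists>f'. ranked_represents f' ([x, y, x, y] @ filter (\<lambda>v. v \<notin> {x, y}) u) V E"
      proof (rule ranked_represents_replace_component[OF rep \<open>finite V\<close> _ no_edges _ _ _ _ avoids_g])
        show "inj_on g {x, y}" using y by (simp add: g_def)
        show "alternate a b [x, y, x, y] \<longleftrightarrow> {a, b} \<in> E"
          if "a \<in> {x, y}" "b \<in> {x, y}" "a \<noteq> b" for a b
          using that alt_p y alternate_sym[of x y] by (auto simp: insert_commute)
      qed (use y \<open>x \<in> V\<close> in auto)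
      then obtain f' where
        "ranked_represents f' ([x, y, x, y] @ filter (\<lambda>v. v \<notin> {x, y}) u) V E" ..
      moreover have "{v. 3 \<le> count_list ([x, y, x, y] @ filter (\<lambda>v. v \<notin> {x, y}) u) v}
          \<subset> {v. 3 \<le> count_list u v}"
        using count y by (auto simp: count_list_filter split: if_splits)
      ultimately show ?thesis by blast
    qed
  qed
qed

lemma ranked_represents_at_most_twice:
  assumes "finite V" "ranked_represents f u V E"
  shows "\<exists>f' u'. ranked_represents f' u' V E \<and> (\<forall>v. count_list u' v \<le> 2)"
  using assms(2)
proof (induction "card {v. 3 \<le> count_list u v}" arbitrary: f u rule: less_induct)
  case less
  show ?case
  proof (cases "\<exists>x. 3 \<le> count_list u x")
    case False
    then have "\<forall>v. count_list u v \<le> 2"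
      by (metis not_less_eq_eq numeral_2_eq_2 numeral_3_eq_3)
    with less.prems show ?thesis by blast
  next
    case True
    then obtain f' u' where u': "ranked_represents f' u' V E"
      "{v. 3 \<le> count_list u' v} \<subset> {v. 3 \<le> count_list u v}"
      using ranked_represents_shorten_letter[OF less.prems \<open>finite V\<close>] by blast
    have "{v. 3 \<le> count_list u v} \<subseteq> set u"
    proof clarify
      fix v assume "3 \<le> count_list u v"
      then show "v \<in> set u" using count_list_0_iff[of u v] by auto
    qed
    then have "finite {v. 3 \<le> count_list u v}"
      by (rule finite_subset) simp
    with u' less.hyps show ?thesis
      by (metis psubset_card_mono)
  qed
qed

section \<open>Passing between ranks and labels\<close>

text \<open>The sets of smaller elements are nested, and \<open>v\<close> itself separates them when
  \<open>h v < h w\<close>. Counting them thus turns any order on \<open>V\<close> into integer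
  ranks.\<close>

lemma card_less_less_iff:
  fixes h :: "'a \<Rightarrow> 'b::linorder"
  assumes "finite V" "v \<in> V" "w \<in> V"
  shows "card {t \<in> V. h t < h v} < card {t \<in> V. h t < h w} \<longleftrightarrow> h v < h w"
proof
  assume "h v < h w"
  then show "card {t \<in> V. h t < h v} < card {t \<in> V. h t < h w}"
    using assms by (intro psubset_card_mono) auto
next
  assume less: "card {t \<in> V. h t < h v} < card {t \<in> V. h t < h w}"
  show "h v < h w"
  proof (rule ccontr)
    assume "\<not> h v < h w"
    then have "card {t \<in> V. h t < h w} \<le> card {t \<in> V. h t < h v}"
      using assms by (intro card_mono) auto
    with less show False by simp
  qed
qed

lemma order_transfer:
  fixes h :: "'a \<Rightarrow> 'b::linorder" and lab :: "'a \<Rightarrow> 'c::linorder"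
  assumes "finite V" "inj_on lab V"
  obtains g :: "'a \<Rightarrow> 'c" where "\<And>v w. v \<in> V \<Longrightarrow> w \<in> V \<Longrightarrow> g v < g w \<longleftrightarrow> h v < h w"
proof
  define r where "r = (\<lambda>v. card {t \<in> V. h t < h v})"
  define l where "l = sorted_list_of_set (lab ` V)"
  have len: "length l = card V"
    using assms by (simp add: l_def card_image)
  have nth: "l ! i < l ! j" if "i < j" "j < card V" for i j
    using sorted_wrt_nth_less[of "(<)" l i j] that len by (simp add: l_def)
  fix v w assume vw: "v \<in> V" "w \<in> V"
  \<comment> \<open>Ranks start at 0 and \<open>v\<close> is not counted below itself, so they are
    valid positions in \<open>l\<close>.\<close>
  have "r v < card V" "r w < card V"
    unfolding r_def using vw \<open>finite V\<close> by (auto intro!: psubset_card_mono)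
  then have "l ! r v < l ! r w \<longleftrightarrow> r v < r w"
    using nth by (metis linorder_cases order_less_asym order_less_irrefl)
  then show "l ! r v < l ! r w \<longleftrightarrow> h v < h w"
    using card_less_less_iff[OF \<open>finite V\<close> vw] by (simp add: r_def)
qed

lemma alternate_map:
  assumes "inj_on g (insert x (insert y (set u)))" "x \<noteq> y"
  shows "alternate (g x) (g y) (map g u) \<longleftrightarrow> alternate x y u"
proof -
  have "filter (\<lambda>z. z = g x \<or> z = g y) (map g u) = map g (filter (\<lambda>z. z = x \<or> z = y) u)"
    unfolding filter_map comp_def
    by (intro arg_cong[of _ _ "map g"] filter_cong) (use assms in \<open>auto simp: inj_on_def\<close>)
  moreover have "g x \<noteq> g y" using assms by (auto simp: inj_on_def)
  moreover have "inj_on g (set (filter (\<lambda>z. z = x \<or> z = y) u))"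
    using assms(1) by (rule inj_on_subset) auto
  ultimately show ?thesis
    using assms(2) by (simp add: alternate_iff_distinct_adj distinct_adj_map_iff)
qed

text \<open>Used both ways: with \<open>lab\<close> to pass from labels to vertices, and with the
  new labeling to return. Edges lie inside \<open>V\<close>, where taking images under
  \<open>g\<close> is injective.\<close>

lemma represents_map:
  assumes inj: "inj_on g V" and "set u \<subseteq> V" and E: "\<And>e. e \<in> E \<Longrightarrow> e \<subseteq> V"
  shows "represents (map g u) (g ` V) ((`) g ` E) \<longleftrightarrow> represents u V E"
proof -
  have "alternate (g x) (g y) (map g u) \<longleftrightarrow> alternate x y u" if "x \<in> V" "y \<in> V" "x \<noteq> y" for x y
    by (rule alternate_map[OF inj_on_subset[OF inj]]) (use that assms in auto)
  moreover have "{g x, g y} \<in> (`) g ` E \<longleftrightarrow> {x, y} \<in> E" if "x \<in> V" "y \<in> V" for x y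
  proof -
    have "inj_on ((`) g) (Pow V)" using inj by (rule inj_on_image_Pow)
    then have "g ` {x, y} \<in> (`) g ` E \<longleftrightarrow> {x, y} \<in> E"
      by (rule inj_on_image_mem_iff) (use that E in auto)
    then show ?thesis by simp
  qed
  moreover have "g x = g y \<longleftrightarrow> x = y" if "x \<in> V" "y \<in> V" for x y
    using that inj by (auto simp: inj_on_def)
  ultimately show ?thesis
    using assms(2) unfolding represents_def by auto
qed

lemma count_list_map:
  assumes "inj_on g (insert x (set u))"
  shows "count_list (map g u) (g x) = count_list u x"
  using assms by (induction u) (auto simp: inj_on_def)

theorem theorem3p4:
  fixes V :: "'a set" and E :: "'a set set"
  assumes "simple_graph V E"
    and "representable_123 TYPE('l::linorder) V E"
  shows "\<exists>(lab :: 'a \<Rightarrow> 'l) w. represents_123 lab w V E \<and> (\<forall>x. count_list w x \<le> 2)"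
proof -
  have fin: "finite V" and E: "\<And>e. e \<in> E \<Longrightarrow> e \<subseteq> V"
    using assms(1) by (auto simp: simple_graph_def)
  obtain lab :: "'a \<Rightarrow> 'l" and w where lab: "inj_on lab V"
    and w: "represents w (lab ` V) ((`) lab ` E)" "avoids_123 w"
    using assms(2) by (auto simp: representable_123_def represents_123_def)
  have w_V: "set w \<subseteq> lab ` V" using w(1) by (simp add: represents_def)
  \<comment> \<open>The word is pulled back to the vertices, since the order on them is about to
    change.\<close>
  define u where "u = map (inv_into V lab) w"
  have map_u: "map lab u = w"
    using w_V by (auto simp: u_def f_inv_into_f intro!: map_idI)
  have u_V: "set u \<subseteq> V"
    using w_V by (auto simp: u_def inv_into_into)
  have rep_u: "represents u V E"
    using represents_map[OF lab u_V E] w(1) map_u by simp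
  define f where "f = (\<lambda>v. int (card {t \<in> V. lab t < lab v}))"
  have f: "f v < f w \<longleftrightarrow> lab v < lab w" if "v \<in> V" "w \<in> V" for v w
    using card_less_less_iff[OF fin that] by (simp add: f_def)
  have "inj_on f V"
  proof (rule inj_onI)
    fix a b assume "a \<in> V" "b \<in> V" "f a = f b"
    then show "a = b"
      using f[of a b] f[of b a] lab by (auto simp: inj_on_def)
  qed
  moreover have "avoids_123 (map f u)"
    using w(2) unfolding map_u[symmetric] by (rule avoids_123_map_mono) (use f u_V in auto)
  ultimately have "ranked_represents f u V E"
    using rep_u by (simp add: ranked_represents_def)
  then obtain f' u' where "ranked_represents f' u' V E" and count: "\<forall>v. count_list u' v \<le> 2"
    using ranked_represents_at_most_twice[OF fin] by blast
  then have inj': "inj_on f' V" and rep': "represents u' V E" and avoids': "avoids_123 (map f' u')"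
    by (auto simp: ranked_represents_def)
  have u'_V: "set u' \<subseteq> V" using rep' by (simp add: represents_def)
  \<comment> \<open>The final labeling realizes the order of the new ranks \<open>f'\<close> within
    the original label type.\<close>
  obtain g :: "'a \<Rightarrow> 'l" where g: "\<And>v w. v \<in> V \<Longrightarrow> w \<in> V \<Longrightarrow> g v < g w \<longleftrightarrow> f' v < f' w"
    using order_transfer[OF fin lab] by blast
  have inj_g: "inj_on g V"
  proof (rule inj_onI)
    fix a b assume "a \<in> V" "b \<in> V" "g a = g b"
    then show "a = b"
      using g[of a b] g[of b a] inj' by (auto simp: inj_on_def)
  qed
  have "represents (map g u') (g ` V) ((`) g ` E)"
    using represents_map[OF inj_g u'_V E] rep' by simp
  moreover have "avoids_123 (map g u')"
    using avoids' by (rule avoids_123_map_mono) (use g u'_V in auto)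
  moreover have "count_list (map g u') x \<le> 2" for x
  proof (cases "x \<in> set (map g u')")
    case True
    then obtain v where "v \<in> set u'" "x = g v" by auto
    moreover from this have "inj_on g (insert v (set u'))"
      using u'_V by (intro inj_on_subset[OF inj_g]) auto
    ultimately show ?thesis
      using count by (simp add: count_list_map)
  qed (simp add: count_notin)
  ultimately show ?thesis
    using inj_g by (auto simp: represents_123_def)
qed

end
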